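(* Let $\Lambda$ be an $S$-sorted set of formulas. For any $s\in S$, if $\Phi\subseteq Form_s$ is $\mathbf K\Lambda$-consistent, then $\Phi$ is satisfiable over the canonical model $\mathcal M^{\mathbf K\Lambda}$, i.e. there is $w\in W^{\mathbf K\Lambda}_s$ with $\mathcal M^{\mathbf K\Lambda},w\models^s\phi$ for all $\phi\in\Phi$.
   Context: Let $(S,\Sigma)$ be a many-sorted signature (each $\sigma\in\Sigma$ has a type $s_1\ldots s_n\to s$, $n\ge0$; $\Sigma_{s_1\ldots s_n,s}$ the symbols of that type; $[n]=\{1,\ldots,n\}$), and $P=\{P_s\}_{s\in S}$ nonempty pairwise disjoint sets of propositional variables. Formulas $Form_s$: $P_s\subseteq Form_s$, closure under $\neg,\vee$ within a sort, and $\sigma(\phi_1,\ldots,\phi_n)\in Form_s$ for $\sigma\in\Sigma_{s_1\ldots s_n,s}$, $\phi_i\in Form_{s_i}$. Abbreviations: $\wedge,\to,\leftrightarrow$; $\bot_s:=p\wedge\neg p$ for fixed $p\in P_s$; for $n\ge1$, $\sigma^\Box(\phi_1,\ldots,\phi_n):=\neg\sigma(\neg\phi_1,\ldots,\neg\phi_n)$. $\mathbf K=\{\mathbf K_s\}$: the least $S$-sorted set containing in each sort all classical propositional theorems and, for $n\ge1$, $\sigma\in\Sigma_{s_1\ldots s_n,s}$, $i\in[n]$, $\psi_j\in Form_{s_j}$, $\phi,\chi\in Form_{s_i}$, the axioms $\sigma^\Box(\ldots,\phi\to\chi,\ldots)\to(\sigma^\Box(\ldots,\phi,\ldots)\to\sigma^\Box(\ldots,\chi,\ldots))$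 (position $i$, other arguments $\psi_j$) and $\sigma(\psi_1,\ldots,\psi_n)\leftrightarrow\neg\sigma^\Box(\neg\psi_1,\ldots,\neg\psi_n)$. $\mathbf K\Lambda_s$ is $\mathbf K_s$ plus all sort-preserving uniform substitution instances of formulas of $\Lambda_s$. Rules: modus ponens within a sort; universal generalization (from $\phi\in Form_{s_i}$ infer $\sigma^\Box(\psi_1,\ldots,\psi_{i-1},\phi,\psi_{i+1},\ldots,\psi_n)$, $n\ge1$). $\vdash^s_{\mathbf K\Lambda}\phi$: $\phi\in Form_s$ has a finite proof from $\mathbf K\Lambda$ by these rules. $\Phi_s\vdash^s_{\mathbf K\Lambda}\phi$: there are $\phi_1,\ldots,\phi_n\in\Phi_s$ with $\vdash^s_{\mathbf K\Lambda}(\phi_1\wedge\cdots\wedge\phi_n)\to\phi$. $\Phi_s\subseteq Form_s$ is $\mathbf K\Lambda$-consistent if not $\Phi_s\vdash^s_{\mathbf K\Lambda}\bot_s$; maximal $\mathbf K\Lambda$-consistent if it is maximal under inclusion among consistent subsets of $Form_s$. Canonical model $\mathcal M^{\mathbf K\Lambda}=(\{W^{\mathbf K\Lambda}_s\},\{R^{\mathbf K\Lambda}_\sigma\},V^{\mathbf K\Lambda})$: $W^{\mathbf K\Lambda}_s$ is the set of maximal $\mathbf K\Lambda$-consistent subsets of $Form_s$; for $\sigma\in\Sigma_{s_1\ldots s_n,s}$, $R^{\mathbf K\Lambda}_\sigma wu_1\ldots u_n$ iff for all $(\psi_1,\ldots,\psi_n)\in u_1\times\cdots\times u_n$, $\sigma(\psi_1,\ldots,\psi_n)\in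 w$; $V^{\mathbf K\Lambda}_s(p)=\{w\in W^{\mathbf K\Lambda}_s\mid p\in w\}$. Satisfaction $\mathcal M,w\models^s\phi$ in a model: $w\in V_s(p)$ for variables, classical for $\neg,\vee$, and $\mathcal M,w\models^s\sigma(\phi_1,\ldots,\phi_n)$ iff there are $w_i\in W_{s_i}$ with $R_\sigma ww_1\ldots w_n$ and $\mathcal M,w_i\models^{s_i}\phi_i$ for all $i$. *)

theory Defs
  imports Main
begin

datatype ('f, 'p) form =
    Var 'p
  | Neg "('f, 'p) form"
  | Or "('f, 'p) form" "('f, 'p) form"
  | Op 'f "('f, 'p) form list"

text \<open>A many-sorted signature together with its sorted propositional variables: the symbol
  \<open>f\<close> has type \<open>dom_sorts f \<rightarrow> cod_sort f\<close>, and \<open>bot_var s\<close> is the fixed variable of sort \<open>s\<close>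
  used to define falsum in that sort.\<close>

record ('s, 'f, 'p) signature =
  sorts :: "'s set"
  ops :: "'f set"
  dom_sorts :: "'f \<Rightarrow> 's list"
  cod_sort :: "'f \<Rightarrow> 's"
  pvars :: "'s \<Rightarrow> 'p set"
  bot_var :: "'s \<Rightarrow> 'p"

definition wf_signature :: "('s, 'f, 'p) signature \<Rightarrow> bool" where
  "wf_signature \<Sigma> \<longleftrightarrow>
     (\<forall>f\<in>ops \<Sigma>. set (dom_sorts \<Sigma> f) \<subseteq> sorts \<Sigma> \<and> cod_sort \<Sigma> f \<in> sorts \<Sigma>) \<and>
     (\<forall>s\<in>sorts \<Sigma>. pvars \<Sigma> s \<noteq> {}) \<and>
     (\<forall>s\<in>sorts \<Sigma>. \<forall>t\<in>sorts \<Sigma>. s \<noteq> t \<longrightarrow> pvars \<Sigma> s \<inter> pvars \<Sigma> t = {}) \<and>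
     (\<forall>s\<in>sorts \<Sigma>. bot_var \<Sigma> s \<in> pvars \<Sigma> s)"

inductive wff :: "('s, 'f, 'p) signature \<Rightarrow> 's \<Rightarrow> ('f, 'p) form \<Rightarrow> bool"
  for \<Sigma> :: "('s, 'f, 'p) signature" where
  Var: "s \<in> sorts \<Sigma> \<Longrightarrow> p \<in> pvars \<Sigma> s \<Longrightarrow> wff \<Sigma> s (Var p)"
| Neg: "wff \<Sigma> s \<phi> \<Longrightarrow> wff \<Sigma> s (Neg \<phi>)"
| Or: "wff \<Sigma> s \<phi> \<Longrightarrow> wff \<Sigma> s \<psi> \<Longrightarrow> wff \<Sigma> s (Or \<phi> \<psi>)"
| Op: "f \<in> ops \<Sigma> \<Longrightarrow> list_all2 (wff \<Sigma>) (dom_sorts \<Sigma> f) \<phi>s \<Longrightarrow> wff \<Sigma> (cod_sort \<Sigma> f) (Op f \<phi>s)"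

definition Form :: "('s, 'f, 'p) signature \<Rightarrow> 's \<Rightarrow> ('f, 'p) form set" where
  "Form \<Sigma> s = {\<phi>. wff \<Sigma> s \<phi>}"

definition And :: "('f, 'p) form \<Rightarrow> ('f, 'p) form \<Rightarrow> ('f, 'p) form" where
  "And \<phi> \<psi> = Neg (Or (Neg \<phi>) (Neg \<psi>))"

definition Imp :: "('f, 'p) form \<Rightarrow> ('f, 'p) form \<Rightarrow> ('f, 'p) form" where
  "Imp \<phi> \<psi> = Or (Neg \<phi>) \<psi>"

definition Iff :: "('f, 'p) form \<Rightarrow> ('f, 'p) form \<Rightarrow> ('f, 'p) form" where
  "Iff \<phi> \<psi> = And (Imp \<phi> \<psi>) (Imp \<psi> \<phi>)"

definition Bot :: "('s, 'f, 'p) signature \<Rightarrow> 's \<Rightarrow> ('f, 'p) form" where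
  "Bot \<Sigma> s = And (Var (bot_var \<Sigma> s)) (Neg (Var (bot_var \<Sigma> s)))"

definition Box :: "'f \<Rightarrow> ('f, 'p) form list \<Rightarrow> ('f, 'p) form" where
  "Box f \<phi>s = Neg (Op f (map Neg \<phi>s))"

text \<open>Classical propositional theorems are the formulas true under every Boolean valuation that
  treats variables and formulas headed by an operation symbol as atoms.\<close>

primrec prop_eval :: "(('f, 'p) form \<Rightarrow> bool) \<Rightarrow> ('f, 'p) form \<Rightarrow> bool" where
  "prop_eval v (Var p) \<longleftrightarrow> v (Var p)"
| "prop_eval v (Neg \<phi>) \<longleftrightarrow> \<not> prop_eval v \<phi>"
| "prop_eval v (Or \<phi> \<psi>) \<longleftrightarrow> prop_eval v \<phi> \<or> prop_eval v \<psi>"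
| "prop_eval v (Op f \<phi>s) \<longleftrightarrow> v (Op f \<phi>s)"

definition prop_theorem :: "('f, 'p) form \<Rightarrow> bool" where
  "prop_theorem \<phi> \<longleftrightarrow> (\<forall>v. prop_eval v \<phi>)"

text \<open>The side condition \<open>i < length (dom_sorts \<Sigma> f)\<close> forces the arity to be at least 1.\<close>

inductive K_axiom :: "('s, 'f, 'p) signature \<Rightarrow> 's \<Rightarrow> ('f, 'p) form \<Rightarrow> bool"
  for \<Sigma> :: "('s, 'f, 'p) signature" where
  taut: "\<phi> \<in> Form \<Sigma> s \<Longrightarrow> prop_theorem \<phi> \<Longrightarrow> K_axiom \<Sigma> s \<phi>"
| dist: "f \<in> ops \<Sigma> \<Longrightarrow> i < length (dom_sorts \<Sigma> f) \<Longrightarrow>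
    list_all2 (wff \<Sigma>) (dom_sorts \<Sigma> f) \<psi>s \<Longrightarrow>
    \<phi> \<in> Form \<Sigma> (dom_sorts \<Sigma> f ! i) \<Longrightarrow> \<chi> \<in> Form \<Sigma> (dom_sorts \<Sigma> f ! i) \<Longrightarrow>
    K_axiom \<Sigma> (cod_sort \<Sigma> f)
      (Imp (Box f (\<psi>s[i := Imp \<phi> \<chi>])) (Imp (Box f (\<psi>s[i := \<phi>])) (Box f (\<psi>s[i := \<chi>]))))"
| dual: "f \<in> ops \<Sigma> \<Longrightarrow> dom_sorts \<Sigma> f \<noteq> [] \<Longrightarrow>
    list_all2 (wff \<Sigma>) (dom_sorts \<Sigma> f) \<psi>s \<Longrightarrow>
    K_axiom \<Sigma> (cod_sort \<Sigma> f) (Iff (Op f \<psi>s) (Neg (Box f (map Neg \<psi>s))))"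

primrec subst :: "('p \<Rightarrow> ('f, 'p) form) \<Rightarrow> ('f, 'p) form \<Rightarrow> ('f, 'p) form" where
  "subst \<theta> (Var p) = \<theta> p"
| "subst \<theta> (Neg \<phi>) = Neg (subst \<theta> \<phi>)"
| "subst \<theta> (Or \<phi> \<psi>) = Or (subst \<theta> \<phi>) (subst \<theta> \<psi>)"
| "subst \<theta> (Op f \<phi>s) = Op f (map (subst \<theta>) \<phi>s)"

definition sort_preserving :: "('s, 'f, 'p) signature \<Rightarrow> ('p \<Rightarrow> ('f, 'p) form) \<Rightarrow> bool" where
  "sort_preserving \<Sigma> \<theta> \<longleftrightarrow> (\<forall>s\<in>sorts \<Sigma>. \<forall>p\<in>pvars \<Sigma> s. \<theta> p \<in> Form \<Sigma> s)"

definition KL :: "('s, 'f, 'p) signature \<Rightarrow> ('s \<Rightarrow> ('f, 'p) form set) \<Rightarrow> 's \<Rightarrow> ('f, 'p) form set"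
  where
  "KL \<Sigma> \<Lambda> s = {\<phi>. K_axiom \<Sigma> s \<phi>} \<union> {subst \<theta> \<xi> | \<theta> \<xi>. sort_preserving \<Sigma> \<theta> \<and> \<xi> \<in> \<Lambda> s}"

inductive provable ::
  "('s, 'f, 'p) signature \<Rightarrow> ('s \<Rightarrow> ('f, 'p) form set) \<Rightarrow> 's \<Rightarrow> ('f, 'p) form \<Rightarrow> bool"
  for \<Sigma> :: "('s, 'f, 'p) signature" and \<Lambda> :: "'s \<Rightarrow> ('f, 'p) form set" where
  ax: "s \<in> sorts \<Sigma> \<Longrightarrow> \<phi> \<in> KL \<Sigma> \<Lambda> s \<Longrightarrow> provable \<Sigma> \<Lambda> s \<phi>"
| mp: "provable \<Sigma> \<Lambda> s \<phi> \<Longrightarrow> provable \<Sigma> \<Lambda> s (Imp \<phi> \<psi>) \<Longrightarrow> provable \<Sigma> \<Lambda> s \<psi>"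
| ug: "f \<in> ops \<Sigma> \<Longrightarrow> i < length (dom_sorts \<Sigma> f) \<Longrightarrow>
    list_all2 (wff \<Sigma>) (dom_sorts \<Sigma> f) \<psi>s \<Longrightarrow>
    provable \<Sigma> \<Lambda> (dom_sorts \<Sigma> f ! i) \<phi> \<Longrightarrow>
    provable \<Sigma> \<Lambda> (cod_sort \<Sigma> f) (Box f (\<psi>s[i := \<phi>]))"

text \<open>The empty conjunction is verum, so that theorems are derivable from the empty set.\<close>

fun Conj :: "('s, 'f, 'p) signature \<Rightarrow> 's \<Rightarrow> ('f, 'p) form list \<Rightarrow> ('f, 'p) form" where
  "Conj \<Sigma> s [] = Neg (Bot \<Sigma> s)"
| "Conj \<Sigma> s [\<phi>] = \<phi>"
| "Conj \<Sigma> s (\<phi> # \<psi> # \<phi>s) = And \<phi> (Conj \<Sigma> s (\<psi> # \<phi>s))"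

definition derivable :: "('s, 'f, 'p) signature \<Rightarrow> ('s \<Rightarrow> ('f, 'p) form set) \<Rightarrow> 's \<Rightarrow>
    ('f, 'p) form set \<Rightarrow> ('f, 'p) form \<Rightarrow> bool" where
  "derivable \<Sigma> \<Lambda> s \<Phi> \<phi> \<longleftrightarrow> (\<exists>\<phi>s. set \<phi>s \<subseteq> \<Phi> \<and> provable \<Sigma> \<Lambda> s (Imp (Conj \<Sigma> s \<phi>s) \<phi>))"

definition consistent :: "('s, 'f, 'p) signature \<Rightarrow> ('s \<Rightarrow> ('f, 'p) form set) \<Rightarrow> 's \<Rightarrow>
    ('f, 'p) form set \<Rightarrow> bool" where
  "consistent \<Sigma> \<Lambda> s \<Phi> \<longleftrightarrow> \<Phi> \<subseteq> Form \<Sigma> s \<and> \<not> derivable \<Sigma> \<Lambda> s \<Phi> (Bot \<Sigma> s)"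

definition max_consistent :: "('s, 'f, 'p) signature \<Rightarrow> ('s \<Rightarrow> ('f, 'p) form set) \<Rightarrow> 's \<Rightarrow>
    ('f, 'p) form set \<Rightarrow> bool" where
  "max_consistent \<Sigma> \<Lambda> s \<Phi> \<longleftrightarrow>
     consistent \<Sigma> \<Lambda> s \<Phi> \<and> (\<forall>\<Psi>. consistent \<Sigma> \<Lambda> s \<Psi> \<and> \<Phi> \<subseteq> \<Psi> \<longrightarrow> \<Psi> = \<Phi>)"

record ('s, 'f, 'p, 'w) model =
  worlds :: "'s \<Rightarrow> 'w set"
  rel :: "'f \<Rightarrow> 'w \<Rightarrow> 'w list \<Rightarrow> bool"
  val :: "'s \<Rightarrow> 'p \<Rightarrow> 'w set"

function sat :: "('s, 'f, 'p) signature \<Rightarrow> ('s, 'f, 'p, 'w) model \<Rightarrow> 's \<Rightarrow> 'w \<Rightarrow>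
    ('f, 'p) form \<Rightarrow> bool" where
  "sat \<Sigma> M s w (Var p) \<longleftrightarrow> w \<in> val M s p"
| "sat \<Sigma> M s w (Neg \<phi>) \<longleftrightarrow> \<not> sat \<Sigma> M s w \<phi>"
| "sat \<Sigma> M s w (Or \<phi> \<psi>) \<longleftrightarrow> sat \<Sigma> M s w \<phi> \<or> sat \<Sigma> M s w \<psi>"
| "sat \<Sigma> M s w (Op f \<phi>s) \<longleftrightarrow>
     (\<exists>ws. list_all2 (\<lambda>t u. u \<in> worlds M t) (dom_sorts \<Sigma> f) ws \<and> rel M f w ws \<and>
       (\<forall>i<length \<phi>s. sat \<Sigma> M (dom_sorts \<Sigma> f ! i) (ws ! i) (\<phi>s ! i)))"
  by pat_completeness auto
termination
proof (relation "measure (\<lambda>(\<Sigma>, M, s, w, \<phi>). size \<phi>)", goal_cases)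
  case (5 \<Sigma> M s w f \<phi>s ws i)
  then have "size (\<phi>s ! i) \<le> size_list size \<phi>s"
    by (intro size_list_estimation') auto
  then show ?case by simp
qed auto

definition canonical_model :: "('s, 'f, 'p) signature \<Rightarrow> ('s \<Rightarrow> ('f, 'p) form set) \<Rightarrow>
    ('s, 'f, 'p, ('f, 'p) form set) model" where
  "canonical_model \<Sigma> \<Lambda> =
    \<lparr> worlds = (\<lambda>s. {w. max_consistent \<Sigma> \<Lambda> s w}),
      rel = (\<lambda>f w us. f \<in> ops \<Sigma> \<and> max_consistent \<Sigma> \<Lambda> (cod_sort \<Sigma> f) w \<and>
        list_all2 (max_consistent \<Sigma> \<Lambda>) (dom_sorts \<Sigma> f) us \<and>
        (\<forall>\<psi>s. list_all2 (\<in>) \<psi>s us \<longrightarrow> Op f \<psi>s \<in> w)),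
      val = (\<lambda>s p. {w. max_consistent \<Sigma> \<Lambda> s w \<and> Var p \<in> w}) \<rparr>"

end

theory Submission
  imports Defs
begin

text \<open>A Henkin construction. Consistent sets extend to maximal consistent ones by Zorn's lemma, and
  membership in a maximal consistent set coincides with truth in the canonical model. The only hard
  case of this truth lemma is an \<open>n\<close>-ary operation: given \<open>\<sigma>(\<phi>\<^sub>1, \<dots>, \<phi>\<^sub>n) \<in> w\<close>, successors have to be
  found. They are chosen one argument at a time. Once \<open>u\<^sub>1, \<dots>, u\<^sub>k\<close> are fixed, the formulas \<open>\<chi>\<close> for
  which \<open>\<sigma>(\<psi>\<^sub>1, \<dots>, \<psi>\<^sub>k, \<chi>, \<phi>\<^sub>k\<^sub>+\<^sub>2, \<dots>, \<phi>\<^sub>n) \<in> w\<close> for all \<open>\<psi>\<^sub>j \<in> u\<^sub>j\<close> form the complement of an ideal,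
  because \<open>\<sigma>\<close> is monotone, preserves disjunctions and falsum, and each \<open>u\<^sub>j\<close> is closed under
  conjunction. The formula \<open>\<phi>\<^sub>k\<^sub>+\<^sub>1\<close> lies outside this ideal, hence in some maximal consistent set
  \<open>u\<^sub>k\<^sub>+\<^sub>1\<close> disjoint from it.\<close>

section \<open>Well-formed formulas\<close>

lemma wff_Neg_iff [simp]: "wff \<Sigma> s (Neg \<phi>) \<longleftrightarrow> wff \<Sigma> s \<phi>"
  by (auto intro: wff.intros elim: wff.cases)

lemma wff_Or_iff [simp]: "wff \<Sigma> s (Or \<phi> \<psi>) \<longleftrightarrow> wff \<Sigma> s \<phi> \<and> wff \<Sigma> s \<psi>"
  by (auto intro: wff.intros elim: wff.cases)

lemma wff_And_iff [simp]: "wff \<Sigma> s (And \<phi> \<psi>) \<longleftrightarrow> wff \<Sigma> s \<phi> \<and> wff \<Sigma> s \<psi>"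
  by (simp add: And_def)

lemma wff_Imp_iff [simp]: "wff \<Sigma> s (Imp \<phi> \<psi>) \<longleftrightarrow> wff \<Sigma> s \<phi> \<and> wff \<Sigma> s \<psi>"
  by (simp add: Imp_def)

lemma wff_Iff_iff [simp]: "wff \<Sigma> s (Iff \<phi> \<psi>) \<longleftrightarrow> wff \<Sigma> s \<phi> \<and> wff \<Sigma> s \<psi>"
  by (auto simp: Iff_def)

lemma wff_Box:
  assumes "f \<in> ops \<Sigma>" "list_all2 (wff \<Sigma>) (dom_sorts \<Sigma> f) \<phi>s"
  shows "wff \<Sigma> (cod_sort \<Sigma> f) (Box f \<phi>s)"
  using assms by (simp add: Box_def wff.Op list_all2_map2)

lemma list_all2_update_right:
  assumes "list_all2 P xs ys" "i < length xs" "P (xs ! i) y"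
  shows "list_all2 P xs (ys[i := y])"
  using assms by (auto simp: list_all2_conv_all_nth nth_list_update)

lemma wff_subst:
  assumes "sort_preserving \<Sigma> \<theta>" "wff \<Sigma> s \<phi>"
  shows "wff \<Sigma> s (subst \<theta> \<phi>)"
  using assms(2)
proof induction
  case (Var s p)
  then show ?case using assms(1) by (auto simp: sort_preserving_def Form_def)
next
  case (Op f \<phi>s)
  then have "list_all2 (wff \<Sigma>) (dom_sorts \<Sigma> f) (map (subst \<theta>) \<phi>s)"
    by (auto simp: list_all2_conv_all_nth)
  with Op.hyps show ?case by (simp add: wff.Op)
qed simp_all

section \<open>Propositional evaluation\<close>

lemma prop_eval_And [simp]: "prop_eval v (And \<phi> \<psi>) \<longleftrightarrow> prop_eval v \<phi> \<and> prop_eval v \<psi>"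
  by (simp add: And_def)

lemma prop_eval_Imp [simp]: "prop_eval v (Imp \<phi> \<psi>) \<longleftrightarrow> (prop_eval v \<phi> \<longrightarrow> prop_eval v \<psi>)"
  by (simp add: Imp_def)

lemma prop_eval_Iff [simp]: "prop_eval v (Iff \<phi> \<psi>) \<longleftrightarrow> (prop_eval v \<phi> \<longleftrightarrow> prop_eval v \<psi>)"
  by (auto simp: Iff_def)

lemma prop_eval_Bot [simp]: "\<not> prop_eval v (Bot \<Sigma> s)"
  by (simp add: Bot_def)

lemma prop_eval_Conj [simp]: "prop_eval v (Conj \<Sigma> s \<phi>s) \<longleftrightarrow> (\<forall>\<phi>\<in>set \<phi>s. prop_eval v \<phi>)"
  by (induction \<Sigma> s \<phi>s rule: Conj.induct) auto

section \<open>The logic of a set of axioms\<close>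

locale sorted_logic =
  fixes \<Sigma> :: "('s, 'f, 'p) signature"
    and \<Lambda> :: "'s \<Rightarrow> ('f, 'p) form set"
  assumes wf: "wf_signature \<Sigma>"
    and Lambda_Form: "\<And>t. t \<in> sorts \<Sigma> \<Longrightarrow> \<Lambda> t \<subseteq> Form \<Sigma> t"
begin

lemma cod_sort_in_sorts: "f \<in> ops \<Sigma> \<Longrightarrow> cod_sort \<Sigma> f \<in> sorts \<Sigma>"
  using wf by (auto simp: wf_signature_def)

lemma dom_sort_in_sorts: "f \<in> ops \<Sigma> \<Longrightarrow> i < length (dom_sorts \<Sigma> f) \<Longrightarrow> dom_sorts \<Sigma> f ! i \<in> sorts \<Sigma>"
  using wf nth_mem by (fastforce simp: wf_signature_def)

lemma wff_sort: "wff \<Sigma> s \<phi> \<Longrightarrow> s \<in> sorts \<Sigma>"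
  by (induction rule: wff.induct) (simp_all add: cod_sort_in_sorts)

lemma wff_Bot: "s \<in> sorts \<Sigma> \<Longrightarrow> wff \<Sigma> s (Bot \<Sigma> s)"
  using wf by (auto simp: Bot_def wf_signature_def intro: wff.Var)

lemma wff_Conj:
  assumes "s \<in> sorts \<Sigma>" "\<forall>\<phi>\<in>set \<phi>s. wff \<Sigma> s \<phi>"
  shows "wff \<Sigma> s (Conj \<Sigma> s \<phi>s)"
  using assms(2) by (induction \<phi>s rule: induct_list012) (auto simp: wff_Bot assms(1))

lemma K_axiom_wff: "K_axiom \<Sigma> s \<phi> \<Longrightarrow> wff \<Sigma> s \<phi>"
proof (induction rule: K_axiom.induct)
  case (taut \<phi> s)
  then show ?case by (simp add: Form_def)
next
  case (dist f i \<psi>s \<phi> \<chi>)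
  then show ?case by (simp add: Form_def wff_Box list_all2_update_right)
next
  case (dual f \<psi>s)
  then show ?case by (simp add: wff.Op wff_Box list_all2_map2)
qed

text \<open>Well-formedness of a formula can thus be read off from any derivation that mentions it.
  For \<open>mp\<close>, the conclusion is a part of the well-formed implication; for
  \<open>ax\<close>, sortedness of \<Lambda> is what makes it work.\<close>

lemma provable_wff: "provable \<Sigma> \<Lambda> s \<phi> \<Longrightarrow> wff \<Sigma> s \<phi>"
proof (induction rule: provable.induct)
  case (ax s \<phi>)
  then show ?case
    using Lambda_Form[of s] by (auto simp: KL_def Form_def dest: K_axiom_wff intro: wff_subst)
next
  case (mp s \<phi> \<psi>)
  then show ?case by simp
next
  case (ug f i \<psi>s \<phi>)
  then show ?case by (simp add: wff_Box list_all2_update_right)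
qed

lemma K_axiom_provable: "K_axiom \<Sigma> s \<phi> \<Longrightarrow> provable \<Sigma> \<Lambda> s \<phi>"
  using K_axiom_wff wff_sort by (auto simp: KL_def intro!: provable.ax)

text \<open>The premises are discharged one by one into an implication until a tautology remains,
  and \<open>mp\<close> brings them back. All propositional reasoning below becomes a check over
  valuations, in which formulas headed by an operation are atoms; modal facts enter as listed
  premises.\<close>

lemma provable_consequence:
  assumes "\<forall>\<phi>\<in>set \<phi>s. provable \<Sigma> \<Lambda> s \<phi>" "wff \<Sigma> s \<psi>"
    and "\<And>v. \<forall>\<phi>\<in>set \<phi>s. prop_eval v \<phi> \<Longrightarrow> prop_eval v \<psi>"
  shows "provable \<Sigma> \<Lambda> s \<psi>"
  using assms
proof (induction \<phi>s arbitrary: \<psi>)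
  case Nil
  then show ?case
    by (intro K_axiom_provable K_axiom.taut) (auto simp: Form_def prop_theorem_def)
next
  case (Cons \<phi> \<phi>s)
  have "provable \<Sigma> \<Lambda> s (Imp \<phi> \<psi>)"
    using Cons.prems by (intro Cons.IH) (auto simp: provable_wff)
  with Cons.prems(1) show ?case by (auto intro: provable.mp)
qed

lemmas provable_taut = provable_consequence[of "[]", simplified]
lemmas provable_consequence1 = provable_consequence[of "[\<phi>]" for \<phi>, simplified]

section \<open>Operations preserve finite disjunctions\<close>

context
  fixes f \<psi>s i
  assumes f: "f \<in> ops \<Sigma>" and i: "i < length (dom_sorts \<Sigma> f)"
    and \<psi>s: "list_all2 (wff \<Sigma>) (dom_sorts \<Sigma> f) \<psi>s"
begin

text \<open>Freezing all arguments except the one at position \<open>i\<close> turns an operation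
  into a unary normal modality.\<close>

abbreviation (input) "dia \<equiv> \<lambda>\<phi>. Op f (\<psi>s[i := \<phi>])"
abbreviation (input) "box \<equiv> \<lambda>\<phi>. Box f ((map Neg \<psi>s)[i := \<phi>])"

lemma wff_dia: "wff \<Sigma> (dom_sorts \<Sigma> f ! i) \<phi> \<Longrightarrow> wff \<Sigma> (cod_sort \<Sigma> f) (dia \<phi>)"
  by (simp add: f i \<psi>s wff.Op list_all2_update_right)

text \<open>Distribution and generalization only mention operations applied to negated arguments. Taking
  the remaining arguments of the box negated as well, duality transfers them to arbitrary
  arguments \<open>\<psi>s\<close>.\<close>

lemma provable_dia_dual:
  assumes "wff \<Sigma> (dom_sorts \<Sigma> f ! i) \<phi>"
  shows "provable \<Sigma> \<Lambda> (cod_sort \<Sigma> f) (Iff (dia \<phi>) (Neg (box (Neg \<phi>))))"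
proof -
  have "K_axiom \<Sigma> (cod_sort \<Sigma> f) (Iff (dia \<phi>) (Neg (Box f (map Neg (\<psi>s[i := \<phi>])))))"
    using assms i by (intro K_axiom.dual) (auto simp: f \<psi>s list_all2_update_right)
  then show ?thesis by (simp add: K_axiom_provable map_update)
qed

lemma provable_box: "provable \<Sigma> \<Lambda> (dom_sorts \<Sigma> f ! i) \<phi> \<Longrightarrow> provable \<Sigma> \<Lambda> (cod_sort \<Sigma> f) (box \<phi>)"
  by (rule provable.ug) (simp_all add: f i \<psi>s list_all2_map2)

lemma provable_box_dist:
  assumes "wff \<Sigma> (dom_sorts \<Sigma> f ! i) \<phi>" "wff \<Sigma> (dom_sorts \<Sigma> f ! i) \<chi>"
  shows "provable \<Sigma> \<Lambda> (cod_sort \<Sigma> f) (Imp (box (Imp \<phi> \<chi>)) (Imp (box \<phi>) (box \<chi>)))"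
  using assms
  by (intro K_axiom_provable K_axiom.dist) (simp_all add: f i \<psi>s Form_def list_all2_map2)

text \<open>Contraposing the implication, generalizing and distributing gives an implication between
  boxes; duality on both sides turns it back into one between diamonds.\<close>

lemma provable_dia_mono:
  assumes "provable \<Sigma> \<Lambda> (dom_sorts \<Sigma> f ! i) (Imp \<phi> \<chi>)"
  shows "provable \<Sigma> \<Lambda> (cod_sort \<Sigma> f) (Imp (dia \<phi>) (dia \<chi>))"
proof -
  have [simp]: "wff \<Sigma> (dom_sorts \<Sigma> f ! i) \<phi>" "wff \<Sigma> (dom_sorts \<Sigma> f ! i) \<chi>"
    using provable_wff[OF assms] by simp_all
  have "provable \<Sigma> \<Lambda> (dom_sorts \<Sigma> f ! i) (Imp (Neg \<chi>) (Neg \<phi>))"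
    by (rule provable_consequence1[OF assms]) auto
  then have "provable \<Sigma> \<Lambda> (cod_sort \<Sigma> f) (Imp (box (Neg \<chi>)) (box (Neg \<phi>)))"
    using provable_box provable_box_dist provable.mp by fastforce
  then show ?thesis
    by (intro provable_consequence[of "[Imp (box (Neg \<chi>)) (box (Neg \<phi>)),
          Iff (dia \<phi>) (Neg (box (Neg \<phi>))), Iff (dia \<chi>) (Neg (box (Neg \<chi>)))]"])
      (auto simp: provable_dia_dual wff_dia)
qed

lemma provable_dia_Bot: "provable \<Sigma> \<Lambda> (cod_sort \<Sigma> f) (Neg (dia (Bot \<Sigma> (dom_sorts \<Sigma> f ! i))))"
  (is "provable _ _ _ (Neg (dia ?bot))")
proof -
  have [simp]: "wff \<Sigma> (dom_sorts \<Sigma> f ! i) ?bot"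
    using f i by (simp add: wff_Bot dom_sort_in_sorts)
  have "provable \<Sigma> \<Lambda> (dom_sorts \<Sigma> f ! i) (Neg ?bot)"
    by (rule provable_taut) auto
  then show ?thesis
    by (intro provable_consequence[of "[box (Neg ?bot), Iff (dia ?bot) (Neg (box (Neg ?bot)))]"])
      (auto simp: provable_dia_dual wff_dia provable_box)
qed

text \<open>Dually, a box preserves conjunction: generalize the curried tautology that two negations
  yield the negated disjunction, then distribute twice.\<close>

lemma provable_dia_Or:
  assumes [simp]: "wff \<Sigma> (dom_sorts \<Sigma> f ! i) \<phi>" "wff \<Sigma> (dom_sorts \<Sigma> f ! i) \<chi>"
  shows "provable \<Sigma> \<Lambda> (cod_sort \<Sigma> f) (Imp (dia (Or \<phi> \<chi>)) (Or (dia \<phi>) (dia \<chi>)))"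
proof -
  let ?n = "Neg (Or \<phi> \<chi>)"
  have "provable \<Sigma> \<Lambda> (dom_sorts \<Sigma> f ! i) (Imp (Neg \<phi>) (Imp (Neg \<chi>) ?n))"
    by (rule provable_taut) auto
  then show ?thesis
    by (intro provable_consequence[of "[box (Imp (Neg \<phi>) (Imp (Neg \<chi>) ?n)),
          Imp (box (Imp (Neg \<phi>) (Imp (Neg \<chi>) ?n))) (Imp (box (Neg \<phi>)) (box (Imp (Neg \<chi>) ?n))),
          Imp (box (Imp (Neg \<chi>) ?n)) (Imp (box (Neg \<chi>)) (box ?n)),
          Iff (dia \<phi>) (Neg (box (Neg \<phi>))), Iff (dia \<chi>) (Neg (box (Neg \<chi>))),
          Iff (dia (Or \<phi> \<chi>)) (Neg (box ?n))]"])
      (auto simp: provable_dia_dual wff_dia provable_box provable_box_dist)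
qed

end

text \<open>The arguments are replaced one at a time, each replacement being an instance of
  \<open>provable_dia_mono\<close>, and the resulting implications are chained.\<close>

lemma provable_Op_mono:
  assumes f: "f \<in> ops \<Sigma>"
    and \<phi>s: "list_all2 (wff \<Sigma>) (dom_sorts \<Sigma> f) \<phi>s" and \<chi>s: "list_all2 (wff \<Sigma>) (dom_sorts \<Sigma> f) \<chi>s"
    and imp: "\<And>i. i < length \<phi>s \<Longrightarrow> provable \<Sigma> \<Lambda> (dom_sorts \<Sigma> f ! i) (Imp (\<phi>s ! i) (\<chi>s ! i))"
  shows "provable \<Sigma> \<Lambda> (cod_sort \<Sigma> f) (Imp (Op f \<phi>s) (Op f \<chi>s))"
proof -
  have len: "length \<phi>s = length (dom_sorts \<Sigma> f)" "length \<chi>s = length (dom_sorts \<Sigma> f)"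
    using \<phi>s \<chi>s by (auto dest: list_all2_lengthD)
  define mix where "mix k = take k \<chi>s @ drop k \<phi>s" for k
  have mix: "list_all2 (wff \<Sigma>) (dom_sorts \<Sigma> f) (mix k)" for k
    using \<phi>s \<chi>s by (auto simp: mix_def list_all2_conv_all_nth nth_append)
  have "k \<le> length \<phi>s \<Longrightarrow> provable \<Sigma> \<Lambda> (cod_sort \<Sigma> f) (Imp (Op f \<phi>s) (Op f (mix k)))" for k
  proof (induction k)
    case 0
    show ?case by (rule provable_taut) (auto simp: mix_def f \<phi>s wff.Op)
  next
    case (Suc k)
    then have k: "k < length (dom_sorts \<Sigma> f)" using len by simp
    have "mix k = take k \<chi>s @ \<phi>s ! k # drop (Suc k) \<phi>s"
      using k len by (simp add: mix_def Cons_nth_drop_Suc)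
    \<comment> \<open>Neighbouring tuples are both updates of \<open>mix k\<close> at position
      \<open>k\<close>, the shape that unary monotonicity expects.\<close>
    then have 1: "(mix k)[k := \<phi>s ! k] = mix k" and 2: "(mix k)[k := \<chi>s ! k] = mix (Suc k)"
      using k len by (simp_all add: mix_def list_update_append take_Suc_conv_app_nth)
    have "provable \<Sigma> \<Lambda> (cod_sort \<Sigma> f) (Imp (Op f (mix k)) (Op f (mix (Suc k))))"
      using provable_dia_mono[OF f k mix imp, of k] Suc.prems by (simp add: 1 2)
    with Suc show ?case
      by (intro provable_consequence[of
            "[Imp (Op f \<phi>s) (Op f (mix k)), Imp (Op f (mix k)) (Op f (mix (Suc k)))]"])
        (auto simp: f \<phi>s mix wff.Op)
  qed
  from this[of "length \<phi>s"] show ?thesis by (simp add: mix_def len)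
qed

section \<open>Maximal consistent sets\<close>

lemma max_consistent_wff: "max_consistent \<Sigma> \<Lambda> s w \<Longrightarrow> \<phi> \<in> w \<Longrightarrow> wff \<Sigma> s \<phi>"
  by (auto simp: max_consistent_def consistent_def Form_def)

text \<open>By maximality, adding \<phi> makes the set inconsistent, and the finite refutation can
  be turned into a derivation of \<open>Neg \<phi>\<close> from the remaining formulas.\<close>

lemma not_in_max_consistentE:
  assumes w: "max_consistent \<Sigma> \<Lambda> s w" and "wff \<Sigma> s \<phi>" "\<phi> \<notin> w"
  obtains \<phi>s where "set \<phi>s \<subseteq> w" "provable \<Sigma> \<Lambda> s (Imp (Conj \<Sigma> s \<phi>s) (Neg \<phi>))"
proof -
  have "\<not> consistent \<Sigma> \<Lambda> s (insert \<phi> w)"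
    using assms by (auto simp: max_consistent_def)
  then obtain \<theta>s where \<theta>s: "set \<theta>s \<subseteq> insert \<phi> w" "provable \<Sigma> \<Lambda> s (Imp (Conj \<Sigma> s \<theta>s) (Bot \<Sigma> s))"
    using assms by (auto simp: max_consistent_def consistent_def derivable_def Form_def)
  \<comment> \<open>A refutation may use \<phi> any number of times, so every occurrence is removed;
    the shortened conjunction together with \<phi> still entails the original one.\<close>
  let ?\<phi>s = "filter (\<lambda>\<theta>. \<theta> \<noteq> \<phi>) \<theta>s"
  have sub: "set ?\<phi>s \<subseteq> w" using \<theta>s(1) by auto
  have "provable \<Sigma> \<Lambda> s (Imp (Conj \<Sigma> s ?\<phi>s) (Neg \<phi>))"
    using assms(2) sub max_consistent_wff[OF w]
    by (intro provable_consequence1[OF \<theta>s(2)]) (auto intro!: wff_Conj wff_sort)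
  with sub show ?thesis by (rule that)
qed

lemma max_consistent_not_provable_Bot:
  assumes "max_consistent \<Sigma> \<Lambda> s w" "set \<phi>s \<subseteq> w"
  shows "\<not> provable \<Sigma> \<Lambda> s (Imp (Conj \<Sigma> s \<phi>s) (Bot \<Sigma> s))"
  using assms by (auto simp: max_consistent_def consistent_def derivable_def)

text \<open>If \<phi> were missing, some members of \<open>w\<close> would derive
  \<open>Neg \<phi>\<close>; joined with those deriving \<phi>, they would refute
  \<open>w\<close>.\<close>

lemma max_consistent_closed:
  assumes w: "max_consistent \<Sigma> \<Lambda> s w" and \<phi>s: "set \<phi>s \<subseteq> w"
    and imp: "provable \<Sigma> \<Lambda> s (Imp (Conj \<Sigma> s \<phi>s) \<phi>)"
  shows "\<phi> \<in> w"
proof (rule ccontr)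
  have \<phi>: "wff \<Sigma> s \<phi>" using provable_wff[OF imp] by simp
  assume "\<phi> \<notin> w"
  then obtain \<theta>s where \<theta>s: "set \<theta>s \<subseteq> w" "provable \<Sigma> \<Lambda> s (Imp (Conj \<Sigma> s \<theta>s) (Neg \<phi>))"
    using not_in_max_consistentE[OF w \<phi>] by blast
  have "provable \<Sigma> \<Lambda> s (Imp (Conj \<Sigma> s (\<phi>s @ \<theta>s)) (Bot \<Sigma> s))"
    using imp \<theta>s \<phi>s wff_sort[OF \<phi>] max_consistent_wff[OF w]
    by (intro provable_consequence[of
          "[Imp (Conj \<Sigma> s \<phi>s) \<phi>, Imp (Conj \<Sigma> s \<theta>s) (Neg \<phi>)]"]) (auto simp: subset_iff intro!: wff_Conj wff_Bot)
  then show False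
    using max_consistent_not_provable_Bot[OF w, of "\<phi>s @ \<theta>s"] \<phi>s \<theta>s(1) by simp
qed

lemma max_consistent_provable:
  assumes w: "max_consistent \<Sigma> \<Lambda> s w" and \<phi>: "provable \<Sigma> \<Lambda> s \<phi>"
  shows "\<phi> \<in> w"
proof -
  have "provable \<Sigma> \<Lambda> s (Imp (Conj \<Sigma> s []) \<phi>)"
    using provable_wff[OF \<phi>]
    by (intro provable_consequence1[OF \<phi>]) (auto intro: wff_Bot wff_sort)
  with w show ?thesis using max_consistent_closed[of s w "[]"] by simp
qed

lemma max_consistent_imp:
  assumes "max_consistent \<Sigma> \<Lambda> s w" "\<phi> \<in> w" "provable \<Sigma> \<Lambda> s (Imp \<phi> \<psi>)"
  shows "\<psi> \<in> w"
  using max_consistent_closed[of s w "[\<phi>]"] assms by simp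

lemma max_consistent_Neg_iff:
  assumes w: "max_consistent \<Sigma> \<Lambda> s w" and \<phi>: "wff \<Sigma> s \<phi>"
  shows "Neg \<phi> \<in> w \<longleftrightarrow> \<phi> \<notin> w"
proof
  assume "Neg \<phi> \<in> w"
  moreover have "provable \<Sigma> \<Lambda> s (Imp (Conj \<Sigma> s [\<phi>, Neg \<phi>]) (Bot \<Sigma> s))"
    using \<phi> wff_sort[OF \<phi>] by (intro provable_taut) (auto intro: wff_Bot)
  ultimately show "\<phi> \<notin> w"
    using max_consistent_not_provable_Bot[OF w, of "[\<phi>, Neg \<phi>]"] by auto
next
  assume "\<phi> \<notin> w"
  then show "Neg \<phi> \<in> w"
    using not_in_max_consistentE[OF w \<phi>] max_consistent_closed[OF w] by blast
qed

lemma max_consistent_Or_iff: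
  assumes w: "max_consistent \<Sigma> \<Lambda> s w" and wff: "wff \<Sigma> s \<phi>" "wff \<Sigma> s \<psi>"
  shows "Or \<phi> \<psi> \<in> w \<longleftrightarrow> \<phi> \<in> w \<or> \<psi> \<in> w"
proof
  assume or: "Or \<phi> \<psi> \<in> w"
  show "\<phi> \<in> w \<or> \<psi> \<in> w"
  proof (rule ccontr)
    assume "\<not> (\<phi> \<in> w \<or> \<psi> \<in> w)"
    then have "set [Or \<phi> \<psi>, Neg \<phi>] \<subseteq> w"
      using or max_consistent_Neg_iff[OF w wff(1)] by auto
    moreover have "provable \<Sigma> \<Lambda> s (Imp (Conj \<Sigma> s [Or \<phi> \<psi>, Neg \<phi>]) \<psi>)"
      using wff by (intro provable_taut) auto
    ultimately show False
      using max_consistent_closed[OF w] \<open>\<not> (\<phi> \<in> w \<or> \<psi> \<in> w)\<close> by blast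
  qed
next
  have "provable \<Sigma> \<Lambda> s (Imp \<phi> (Or \<phi> \<psi>))" "provable \<Sigma> \<Lambda> s (Imp \<psi> (Or \<phi> \<psi>))"
    using wff by (auto intro!: provable_taut)
  then show "\<phi> \<in> w \<or> \<psi> \<in> w \<Longrightarrow> Or \<phi> \<psi> \<in> w"
    using max_consistent_imp[OF w] by blast
qed

lemma max_consistent_And:
  assumes w: "max_consistent \<Sigma> \<Lambda> s w" and "\<phi> \<in> w" "\<psi> \<in> w"
  shows "And \<phi> \<psi> \<in> w"
  using assms max_consistent_wff[OF w]
  by (intro max_consistent_closed[OF w, of "[\<phi>, \<psi>]"] provable_taut) auto

text \<open>A refutation uses finitely many formulas, so a refutation of the union of a chain
  already lives in one member. This is the chain condition of Zorn's lemma.\<close>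

lemma consistent_extends_to_max_consistent:
  assumes "consistent \<Sigma> \<Lambda> s \<Phi>"
  obtains w where "max_consistent \<Sigma> \<Lambda> s w" "\<Phi> \<subseteq> w"
proof -
  let ?A = "{\<Psi>. consistent \<Sigma> \<Lambda> s \<Psi> \<and> \<Phi> \<subseteq> \<Psi>}"
  have "\<exists>M\<in>?A. \<forall>X\<in>?A. M \<subseteq> X \<longrightarrow> X = M"
  proof (rule subset_Zorn_nonempty)
    show "?A \<noteq> {}" using assms by auto
  next
    fix \<C> assume \<C>: "\<C> \<noteq> {}" "subset.chain ?A \<C>"
    have "\<not> derivable \<Sigma> \<Lambda> s (\<Union>\<C>) (Bot \<Sigma> s)"
    proof
      assume "derivable \<Sigma> \<Lambda> s (\<Union>\<C>) (Bot \<Sigma> s)"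
      then obtain \<phi>s where \<phi>s: "set \<phi>s \<subseteq> \<Union>\<C>" "provable \<Sigma> \<Lambda> s (Imp (Conj \<Sigma> s \<phi>s) (Bot \<Sigma> s))"
        by (auto simp: derivable_def)
      obtain \<Psi> where "\<Psi> \<in> \<C>" "set \<phi>s \<subseteq> \<Psi>"
        using finite_subset_Union_chain[OF _ \<phi>s(1) \<C>] by blast
      then show False
        using \<phi>s(2) \<C>(2) by (auto simp: subset_chain_def consistent_def derivable_def)
    qed
    then show "\<Union>\<C> \<in> ?A"
      using \<C> by (auto simp: subset_chain_def consistent_def)
  qed
  \<comment> \<open>Maximality among the consistent supersets of \<Phi> is maximality outright,
    since anything larger also contains \<Phi>.\<close>
  then show ?thesis using that by (fastforce simp: max_consistent_def)
qed

text \<open>A form of the prime filter theorem: the formulas failing \<open>P\<close> form an ideal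
  that misses \<phi>, and a filter containing \<phi> and the negations of that ideal is
  proper.\<close>

lemma max_consistent_avoiding_ideal:
  assumes \<phi>: "wff \<Sigma> s \<phi>" "P \<phi>"
    and mono: "\<And>\<chi> \<psi>. P \<chi> \<Longrightarrow> provable \<Sigma> \<Lambda> s (Imp \<chi> \<psi>) \<Longrightarrow> P \<psi>"
    and prime: "\<And>\<chi> \<psi>. wff \<Sigma> s \<chi> \<Longrightarrow> wff \<Sigma> s \<psi> \<Longrightarrow> P (Or \<chi> \<psi>) \<Longrightarrow> P \<chi> \<or> P \<psi>"
    and bot: "\<not> P (Bot \<Sigma> s)"
  obtains u where "max_consistent \<Sigma> \<Lambda> s u" "\<phi> \<in> u" "\<forall>\<chi>\<in>u. P \<chi>"
proof -
  have s: "s \<in> sorts \<Sigma>" using \<phi>(1) by (rule wff_sort)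
  \<comment> \<open>the filter generated by \<open>\<phi>\<close> and the negations of the formulas outside \<open>P\<close>\<close>
  define C where "C = {\<theta>. \<exists>\<chi>. wff \<Sigma> s \<chi> \<and> \<not> P \<chi> \<and> provable \<Sigma> \<Lambda> s (Imp \<phi> (Or \<chi> \<theta>))}"
  have C_wff: "wff \<Sigma> s \<theta>" if "\<theta> \<in> C" for \<theta>
    using that by (auto simp: C_def dest: provable_wff)
  \<comment> \<open>Closure under finite conjunctions: the disjunction of two witnesses outside
    \<open>P\<close> is again outside \<open>P\<close> by \<open>prime\<close>, and
    \<open>Bot\<close> is the witness for the empty conjunction.\<close>
  have "Conj \<Sigma> s \<theta>s \<in> C" if "set \<theta>s \<subseteq> C" for \<theta>s
    using that
  proof (induction \<theta>s)
    case Nil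
    have "provable \<Sigma> \<Lambda> s (Imp \<phi> (Or (Bot \<Sigma> s) (Conj \<Sigma> s [])))"
      using \<phi> s by (intro provable_taut) (auto intro: wff_Bot)
    with bot show ?case unfolding C_def using wff_Bot[OF s] by blast
  next
    case (Cons \<theta> \<theta>s)
    then obtain \<chi> \<psi> where *: "wff \<Sigma> s \<chi>" "\<not> P \<chi>" "provable \<Sigma> \<Lambda> s (Imp \<phi> (Or \<chi> \<theta>))"
      "wff \<Sigma> s \<psi>" "\<not> P \<psi>" "provable \<Sigma> \<Lambda> s (Imp \<phi> (Or \<psi> (Conj \<Sigma> s \<theta>s)))"
      by (auto simp: C_def)
    have "provable \<Sigma> \<Lambda> s (Imp \<phi> (Or (Or \<chi> \<psi>) (Conj \<Sigma> s (\<theta> # \<theta>s))))"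
      using * \<phi> s Cons.prems C_wff
      by (intro provable_consequence[of
            "[Imp \<phi> (Or \<chi> \<theta>), Imp \<phi> (Or \<psi> (Conj \<Sigma> s \<theta>s))]"]) (auto simp: subset_iff intro!: wff_Conj)
    moreover have "\<not> P (Or \<chi> \<psi>)" using * prime by blast
    ultimately show ?case unfolding C_def using * by (auto intro: exI[of _ "Or \<chi> \<psi>"])
  qed
  \<comment> \<open>A refutable member of \<open>C\<close> would make \<phi> entail its witness
    \<chi>, and \<open>mono\<close> would put \<chi> into \<open>P\<close>.\<close>
  moreover have "\<not> provable \<Sigma> \<Lambda> s (Imp \<theta> (Bot \<Sigma> s))" if \<theta>: "\<theta> \<in> C" for \<theta>
  proof
    assume "provable \<Sigma> \<Lambda> s (Imp \<theta> (Bot \<Sigma> s))"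
    moreover obtain \<chi> where *: "wff \<Sigma> s \<chi>" "\<not> P \<chi>" "provable \<Sigma> \<Lambda> s (Imp \<phi> (Or \<chi> \<theta>))"
      using \<theta> by (auto simp: C_def)
    ultimately have "provable \<Sigma> \<Lambda> s (Imp \<phi> \<chi>)"
      using \<phi> by (intro provable_consequence[of
            "[Imp \<theta> (Bot \<Sigma> s), Imp \<phi> (Or \<chi> \<theta>)]"]) auto
    with mono \<phi>(2) *(2) show False by blast
  qed
  ultimately have "consistent \<Sigma> \<Lambda> s C"
    using C_wff by (auto simp: consistent_def derivable_def Form_def)
  then obtain u where u: "max_consistent \<Sigma> \<Lambda> s u" "C \<subseteq> u"
    by (rule consistent_extends_to_max_consistent)
  have "provable \<Sigma> \<Lambda> s (Imp \<phi> (Or (Bot \<Sigma> s) \<phi>))"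
    using \<phi> s by (intro provable_taut) (auto intro: wff_Bot)
  then have "\<phi> \<in> C" unfolding C_def using bot wff_Bot[OF s] by blast
  moreover have "P \<chi>" if "\<chi> \<in> u" for \<chi>
  proof (rule ccontr)
    assume "\<not> P \<chi>"
    have \<chi>: "wff \<Sigma> s \<chi>" using max_consistent_wff[OF u(1) that] .
    \<comment> \<open>Excluded middle places \<open>Neg \<chi>\<close> in \<open>C\<close>, with
      \<chi> itself as the witness.\<close>
    have "provable \<Sigma> \<Lambda> s (Imp \<phi> (Or \<chi> (Neg \<chi>)))"
      using \<phi> \<chi> by (intro provable_taut) auto
    with \<open>\<not> P \<chi>\<close> \<chi> have "Neg \<chi> \<in> C" by (auto simp: C_def)
    with u \<chi> that show False using max_consistent_Neg_iff by blast
  qed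
  ultimately show ?thesis using that u by blast
qed

section \<open>The truth lemma\<close>

lemma existence_of_successors:
  assumes f: "f \<in> ops \<Sigma>" and \<phi>s: "list_all2 (wff \<Sigma>) (dom_sorts \<Sigma> f) \<phi>s"
    and w: "max_consistent \<Sigma> \<Lambda> (cod_sort \<Sigma> f) w" and Op_in: "Op f \<phi>s \<in> w"
  obtains us where "list_all2 (max_consistent \<Sigma> \<Lambda>) (dom_sorts \<Sigma> f) us" "list_all2 (\<in>) \<phi>s us"
    and "\<And>\<psi>s. list_all2 (\<in>) \<psi>s us \<Longrightarrow> Op f \<psi>s \<in> w"
proof -
  let ?d = "dom_sorts \<Sigma> f"
  have len: "length \<phi>s = length ?d" using \<phi>s by (auto dest: list_all2_lengthD)
  \<comment> \<open>Invariant after \<open>k\<close> choices: the first \<open>k\<close> arguments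
    may be any members of the chosen sets, while the others are still the original ones. At full
    length nothing original is left; for a constant the empty list of successors suffices.\<close>
  have "k \<le> length ?d \<Longrightarrow> \<exists>us. list_all2 (max_consistent \<Sigma> \<Lambda>) (take k ?d) us \<and>
      list_all2 (\<in>) (take k \<phi>s) us \<and>
      (\<forall>\<psi>s. list_all2 (\<in>) \<psi>s us \<longrightarrow> Op f (\<psi>s @ drop k \<phi>s) \<in> w)" for k
  proof (induction k)
    case 0
    show ?case using Op_in by auto
  next
    case (Suc k)
    then have k: "k < length ?d" "k < length \<phi>s" using len by auto
    obtain us where us: "list_all2 (max_consistent \<Sigma> \<Lambda>) (take k ?d) us"
      "list_all2 (\<in>) (take k \<phi>s) us"
      and Op_us: "\<And>\<psi>s. list_all2 (\<in>) \<psi>s us \<Longrightarrow> Op f (\<psi>s @ drop k \<phi>s) \<in> w"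
      using Suc by auto
    have len_us: "length us = k" using us(1) k by (auto dest: list_all2_lengthD)
    define args where "args \<psi>s \<chi> = \<psi>s @ \<chi> # drop (Suc k) \<phi>s" for \<psi>s \<chi>
    define P where "P \<chi> \<longleftrightarrow> (\<forall>\<psi>s. list_all2 (\<in>) \<psi>s us \<longrightarrow> Op f (args \<psi>s \<chi>) \<in> w)" for \<chi>
    have us_wff: "list_all2 (wff \<Sigma>) (take k ?d) \<psi>s" if "list_all2 (\<in>) \<psi>s us" for \<psi>s
      using that us(1) k by (auto simp: list_all2_conv_all_nth intro: max_consistent_wff)
    have args_wff: "list_all2 (wff \<Sigma>) ?d (args \<psi>s \<chi>)"
      if "list_all2 (\<in>) \<psi>s us" "wff \<Sigma> (?d ! k) \<chi>" for \<psi>s \<chi>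
    proof -
      have "list_all2 (wff \<Sigma>) (take k ?d @ ?d ! k # drop (Suc k) ?d) (args \<psi>s \<chi>)"
        unfolding args_def using that us_wff \<phi>s
        by (intro list_all2_appendI) (auto intro: list_all2_dropI)
      then show ?thesis using k by (simp add: id_take_nth_drop[symmetric])
    qed
    have args_update: "(args \<psi>s \<chi>)[k := \<chi>'] = args \<psi>s \<chi>'"
      if "list_all2 (\<in>) \<psi>s us" for \<psi>s \<chi> \<chi>'
      using list_all2_lengthD[OF that] len_us by (simp add: args_def list_update_append)
    obtain u where u: "max_consistent \<Sigma> \<Lambda> (?d ! k) u" "\<phi>s ! k \<in> u" "\<forall>\<chi>\<in>u. P \<chi>"
    proof (rule max_consistent_avoiding_ideal[of "?d ! k" "\<phi>s ! k" P])
      show \<phi>k: "wff \<Sigma> (?d ! k) (\<phi>s ! k)" using \<phi>s k by (auto simp: list_all2_conv_all_nth)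
      show "P (\<phi>s ! k)"
        using Op_us k by (simp add: P_def args_def Cons_nth_drop_Suc)
      show "P \<psi>" if "P \<chi>" and imp: "provable \<Sigma> \<Lambda> (?d ! k) (Imp \<chi> \<psi>)" for \<chi> \<psi>
        unfolding P_def
      proof (intro allI impI)
        fix \<psi>s assume \<psi>s: "list_all2 (\<in>) \<psi>s us"
        have "wff \<Sigma> (?d ! k) \<chi>" using provable_wff[OF imp] by simp
        then have "provable \<Sigma> \<Lambda> (cod_sort \<Sigma> f) (Imp (Op f (args \<psi>s \<chi>)) (Op f (args \<psi>s \<psi>)))"
          using provable_dia_mono[OF f k(1) args_wff[OF \<psi>s] imp] by (simp add: args_update[OF \<psi>s])
        moreover have "Op f (args \<psi>s \<chi>) \<in> w" using \<open>P \<chi>\<close> \<psi>s by (simp add: P_def)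
        ultimately show "Op f (args \<psi>s \<psi>) \<in> w" using max_consistent_imp[OF w] by blast
      qed
      show "\<not> P (Bot \<Sigma> (?d ! k))"
      proof
        assume "P (Bot \<Sigma> (?d ! k))"
        \<comment> \<open>The quantifier in \<open>P\<close> is not vacuous: the original first
          \<open>k\<close> arguments belong to the chosen sets, which is why the invariant records
          this membership.\<close>
        then have "Op f (args (take k \<phi>s) (Bot \<Sigma> (?d ! k))) \<in> w"
          using us(2) by (simp add: P_def)
        moreover have "provable \<Sigma> \<Lambda> (cod_sort \<Sigma> f)
            (Neg (Op f (args (take k \<phi>s) (Bot \<Sigma> (?d ! k)))))" (is "provable _ _ _ (Neg ?o)")
          using provable_dia_Bot[OF f k(1) args_wff[OF us(2) \<phi>k]] by (simp add: args_update[OF us(2)])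
        then have "Neg ?o \<in> w" by (rule max_consistent_provable[OF w])
        ultimately show False
          using max_consistent_Neg_iff[OF w] max_consistent_wff[OF w] by blast
      qed
      show "P \<chi> \<or> P \<psi>" if wff: "wff \<Sigma> (?d ! k) \<chi>" "wff \<Sigma> (?d ! k) \<psi>" and "P (Or \<chi> \<psi>)" for \<chi> \<psi>
      proof (rule ccontr)
        assume "\<not> (P \<chi> \<or> P \<psi>)"
        then obtain as bs where as: "list_all2 (\<in>) as us" "Op f (args as \<chi>) \<notin> w"
          and bs: "list_all2 (\<in>) bs us" "Op f (args bs \<psi>) \<notin> w"
          by (auto simp: P_def)
        \<comment> \<open>The failures of \<open>P \<chi>\<close> and \<open>P \<psi>\<close> come
          with different tuples. Their componentwise conjunction still lies in the chosen sets and
          is a common strengthening, so that one tuple witnesses both.\<close>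
        define cs where "cs = map2 And as bs"
        have lens: "length as = k" "length bs = k" "length cs = k"
          using list_all2_lengthD[OF as(1)] list_all2_lengthD[OF bs(1)] len_us by (simp_all add: cs_def)
        have cs: "list_all2 (\<in>) cs us"
          using as(1) bs(1) us(1) k
          by (auto simp: cs_def list_all2_conv_all_nth intro: max_consistent_And)
        \<comment> \<open>Contraposed monotonicity: \<open>cs\<close> implies \<open>xs\<close> in
          each component, so failure at \<open>xs\<close> passes to \<open>cs\<close>.\<close>
        have weaken: "Op f (args cs \<theta>) \<notin> w"
          if xs: "list_all2 (\<in>) xs us" and not_in: "Op f (args xs \<theta>) \<notin> w"
            and \<theta>: "wff \<Sigma> (?d ! k) \<theta>" and xs_cs: "xs = as \<or> xs = bs" for xs \<theta>
        proof -
          have "provable \<Sigma> \<Lambda> (cod_sort \<Sigma> f) (Imp (Op f (args cs \<theta>)) (Op f (args xs \<theta>)))"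
          proof (rule provable_Op_mono[OF f args_wff[OF cs \<theta>] args_wff[OF xs \<theta>]])
            fix i assume i: "i < length (args cs \<theta>)"
            have "wff \<Sigma> (?d ! i) (args cs \<theta> ! i)" "wff \<Sigma> (?d ! i) (args xs \<theta> ! i)"
              using i args_wff[OF cs \<theta>] args_wff[OF xs \<theta>] by (auto simp: list_all2_conv_all_nth)
            then show "provable \<Sigma> \<Lambda> (?d ! i) (Imp (args cs \<theta> ! i) (args xs \<theta> ! i))"
              using xs_cs lens
              by (intro provable_taut) (auto simp: args_def nth_append cs_def)
          qed
          then show ?thesis using max_consistent_imp[OF w] not_in by blast
        qed
        have "Op f (args cs (Or \<chi> \<psi>)) \<in> w" using \<open>P (Or \<chi> \<psi>)\<close> cs by (simp add: P_def)
        moreover have "provable \<Sigma> \<Lambda> (cod_sort \<Sigma> f)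
            (Imp (Op f (args cs (Or \<chi> \<psi>))) (Or (Op f (args cs \<chi>)) (Op f (args cs \<psi>))))"
          using provable_dia_Or[OF f k(1) args_wff[OF cs wff(1)] wff] by (simp add: args_update[OF cs])
        ultimately have "Or (Op f (args cs \<chi>)) (Op f (args cs \<psi>)) \<in> w"
          by (rule max_consistent_imp[OF w])
        then have "Op f (args cs \<chi>) \<in> w \<or> Op f (args cs \<psi>) \<in> w"
          using max_consistent_Or_iff[OF w] max_consistent_wff[OF w] by fastforce
        with weaken as bs wff show False by blast
      qed
    qed
    have "list_all2 (max_consistent \<Sigma> \<Lambda>) (take (Suc k) ?d) (us @ [u])"
      "list_all2 (\<in>) (take (Suc k) \<phi>s) (us @ [u])"
      using us u k by (auto simp: take_Suc_conv_app_nth intro!: list_all2_appendI)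
    moreover have "Op f (\<psi>s @ drop (Suc k) \<phi>s) \<in> w" if \<psi>s: "list_all2 (\<in>) \<psi>s (us @ [u])" for \<psi>s
    proof -
      obtain as \<chi> where "\<psi>s = as @ [\<chi>]" "list_all2 (\<in>) as us" "\<chi> \<in> u"
        using \<psi>s by (auto simp: list_all2_append2 list_all2_Cons2)
      then show ?thesis using u(3) by (auto simp: P_def args_def)
    qed
    ultimately show ?case by blast
  qed
  from this[of "length ?d"] show ?thesis using that len by auto
qed

text \<open>In the case of an operation, satisfaction gives membership by applying the canonical
  relation to the arguments themselves; the converse is
  \<open>existence_of_successors\<close>.\<close>

lemma truth_lemma:
  assumes "wff \<Sigma> s \<phi>" "max_consistent \<Sigma> \<Lambda> s w"
  shows "sat \<Sigma> (canonical_model \<Sigma> \<Lambda>) s w \<phi> \<longleftrightarrow> \<phi> \<in> w"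
  using assms
proof (induction arbitrary: w)
  case (Var s p)
  then show ?case by (simp add: canonical_model_def)
next
  case (Neg s \<phi>)
  then show ?case by (simp add: max_consistent_Neg_iff)
next
  case (Or s \<phi> \<psi>)
  then show ?case by (simp add: max_consistent_Or_iff)
next
  case (Op f \<phi>s)
  let ?d = "dom_sorts \<Sigma> f" and ?M = "canonical_model \<Sigma> \<Lambda>"
  have \<phi>s: "list_all2 (wff \<Sigma>) ?d \<phi>s"
    using Op.IH by (rule list_all2_mono) simp
  \<comment> \<open>The induction hypothesis speaks only about maximal consistent sets, hence the
    restriction on \<open>us\<close>.\<close>
  have truth: "(\<forall>i<length \<phi>s. sat \<Sigma> ?M (?d ! i) (us ! i) (\<phi>s ! i)) \<longleftrightarrow> list_all2 (\<in>) \<phi>s us"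
    if "list_all2 (max_consistent \<Sigma> \<Lambda>) ?d us" for us
    using that Op.IH by (auto simp: list_all2_conv_all_nth)
  have sat_iff: "sat \<Sigma> ?M (cod_sort \<Sigma> f) w (Op f \<phi>s) \<longleftrightarrow>
      (\<exists>us. list_all2 (max_consistent \<Sigma> \<Lambda>) ?d us \<and> list_all2 (\<in>) \<phi>s us \<and>
        (\<forall>\<psi>s. list_all2 (\<in>) \<psi>s us \<longrightarrow> Op f \<psi>s \<in> w))"
    using truth Op by (auto simp: canonical_model_def)
  show ?case
    unfolding sat_iff using existence_of_successors[OF Op.hyps(1) \<phi>s Op.prems] by blast
qed

end

theorem mainTheorem10:
  fixes \<Sigma> :: "('s, 'f, 'p) signature"
    and \<Lambda> :: "'s \<Rightarrow> ('f, 'p) form set"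
    and s :: 's
    and \<Phi> :: "('f, 'p) form set"
  assumes "wf_signature \<Sigma>"
    and "\<forall>t\<in>sorts \<Sigma>. \<Lambda> t \<subseteq> Form \<Sigma> t"
    and "s \<in> sorts \<Sigma>"
    and "\<Phi> \<subseteq> Form \<Sigma> s"
    and "consistent \<Sigma> \<Lambda> s \<Phi>"
  shows "\<exists>w\<in>worlds (canonical_model \<Sigma> \<Lambda>) s. \<forall>\<phi>\<in>\<Phi>. sat \<Sigma> (canonical_model \<Sigma> \<Lambda>) s w \<phi>"
proof -
  interpret sorted_logic \<Sigma> \<Lambda>
    using assms(1,2) by unfold_locales auto
  obtain w where w: "max_consistent \<Sigma> \<Lambda> s w" "\<Phi> \<subseteq> w"
    using assms(5) by (rule consistent_extends_to_max_consistent)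
  then have "\<forall>\<phi>\<in>\<Phi>. sat \<Sigma> (canonical_model \<Sigma> \<Lambda>) s w \<phi>"
    using truth_lemma max_consistent_wff by blast
  with w(1) show ?thesis by (auto simp: canonical_model_def)
qed

end
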